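(* Let $(\mathscr{A},\cdot,\alpha)$ be a Hom-anti-associative algebra and $(V,L,R,\beta)$ a bimodule over it. Let $T:V\to\mathscr{A}$ be an $\mathcal{O}$-operator of $(\mathscr{A},\cdot,\alpha)$ associated to $(V,L,R,\beta)$. Define bilinear operations $\succ,\prec$ on $V$ by $$u\succ v=L(T(u))(v),\qquad u\prec v=R(T(v))(u),\qquad u,v\in V.$$ Then $(V,\succ,\prec,\beta)$ is a Hom-rhizaform algebra, and $T$ is a homomorphism of Hom-anti-associative algebras from the associated Hom-anti-associative algebra $(V,\ast,\beta)$, where $u\ast v=u\succ v+u\prec v$, to $(\mathscr{A},\cdot,\alpha)$. Furthermore, there is an induced Hom-rhizaform algebra structure on $T(V)=\{T(u)\mid u\in V\}\subseteq\mathscr{A}$ (with structure map the restriction of $\alpha$) given by $$T(u)\succ T(v)=T(u\succ v),\qquad T(u)\prec T(v)=T(u\prec v),\qquad u,v\in V,$$ and $T:V\to T(V)$ is a homomorphism of Hom-rhizaform algebras.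
   Context: All vector spaces are over a fixed field $\mathbb{F}$. A Hom-anti-associative algebra $(\mathscr{A},\cdot,\alpha)$ is a vector space with a bilinear product $\cdot$ and a linear map $\alpha:\mathscr{A}\to\mathscr{A}$ such that $\alpha(x)\cdot(y\cdot z)=-(x\cdot y)\cdot\alpha(z)$ for all $x,y,z$. A bimodule $(V,L,R,\beta)$ over $(\mathscr{A},\cdot,\alpha)$ is a vector space $V$ with a linear map $\beta:V\to V$ and linear maps $L,R:\mathscr{A}\to\mathrm{End}(V)$ such that for all $a,b\in\mathscr{A}$, $m\in V$: $$L(\alpha(a))(L(b)(m))=-L(a\cdot b)(\beta(m)),\quad R(\alpha(b))(R(a)(m))=-R(a\cdot b)(\beta(m)),$$ $$L(\alpha(a))(R(b)(m))=-R(\alpha(b))(L(a)(m)),$$ $$\beta(L(a)(m))=L(\alpha(a))(\beta(m)),\quad \beta(R(a)(m))=R(\alpha(a))(\beta(m)).$$ An $\mathcal{O}$-operator of $(\mathscr{A},\cdot,\alpha)$ associated to $(V,L,R,\beta)$ is a linear map $T:V\to\mathscr{A}$ with $T\circ\beta=\alpha\circ T$ and $T(u)\cdot T(v)=T\big(L(T(u))(v)+R(T(v))(u)\big)$ for all $u,v\in V$. A Hom-rhizaform algebra is a quadruple $(A,\succ,\prec,\alpha)$ with $A$ a vector space, $\succ,\prec$ bilinear operations on $A$ and $\alpha:A\to A$ linear such that for all $x,y,z\in A$: $\alpha(x\prec y)=\alpha(x)\prec\alpha(y)$, $\alpha(x\succ y)=\alpha(x)\succ\alpha(y)$, and $$(x\succ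 y+x\prec y)\succ\alpha(z)=-\alpha(x)\succ(y\succ z),$$ $$\alpha(x)\prec(y\succ z+y\prec z)=-(x\prec y)\prec\alpha(z),$$ $$\alpha(x)\succ(y\prec z)=-(x\succ y)\prec\alpha(z).$$ Its associated Hom-anti-associative algebra is $(A,\ast,\alpha)$ with $x\ast y=x\succ y+x\prec y$. Homomorphisms (of Hom-anti-associative or Hom-rhizaform algebras) are linear maps preserving the products and intertwining the structure maps, i.e. $\pi\circ\alpha_1=\alpha_2\circ\pi$. *)

theory Defs
  imports Complex_Main "HOL-Library.FuncSet"
begin

text \<open>
  The image of an \<open>\<O>\<close>-operator is in general a proper subspace of its codomain, so every vector
  space is given by a subspace (the carrier) of an ambient type-based vector space. Operations and
  maps are HOL functions of which only the values on carriers matter.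
\<close>

definition linear_on ::
  "('f::field \<Rightarrow> 'a::ab_group_add \<Rightarrow> 'a) \<Rightarrow> ('f \<Rightarrow> 'b::ab_group_add \<Rightarrow> 'b)
    \<Rightarrow> 'a set \<Rightarrow> 'b set \<Rightarrow> ('a \<Rightarrow> 'b) \<Rightarrow> bool" where
  "linear_on s1 s2 A B f \<longleftrightarrow>
     f \<in> A \<rightarrow> B \<and>
     (\<forall>x\<in>A. \<forall>y\<in>A. f (x + y) = f x + f y) \<and>
     (\<forall>c. \<forall>x\<in>A. f (s1 c x) = s2 c (f x))"

definition bilinear_on ::
  "('f::field \<Rightarrow> 'a::ab_group_add \<Rightarrow> 'a) \<Rightarrow> ('f \<Rightarrow> 'b::ab_group_add \<Rightarrow> 'b)
    \<Rightarrow> ('f \<Rightarrow> 'c::ab_group_add \<Rightarrow> 'c)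
    \<Rightarrow> 'a set \<Rightarrow> 'b set \<Rightarrow> 'c set \<Rightarrow> ('a \<Rightarrow> 'b \<Rightarrow> 'c) \<Rightarrow> bool" where
  "bilinear_on s1 s2 s3 A B C f \<longleftrightarrow>
     (\<forall>x\<in>A. linear_on s2 s3 B C (f x)) \<and>
     (\<forall>y\<in>B. linear_on s1 s3 A C (\<lambda>x. f x y))"

locale hom_anti_associative_algebra = vector_space scale
  for scale :: "'f::field \<Rightarrow> 'a::ab_group_add \<Rightarrow> 'a" +
  fixes A :: "'a set"
    and mult :: "'a \<Rightarrow> 'a \<Rightarrow> 'a"
    and \<alpha> :: "'a \<Rightarrow> 'a"
  assumes subspace_carrier: "subspace A"
    and bilinear_mult: "bilinear_on scale scale scale A A A mult"
    and linear_map: "linear_on scale scale A A \<alpha>"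
    and hom_anti_assoc: "\<lbrakk>x \<in> A; y \<in> A; z \<in> A\<rbrakk> \<Longrightarrow>
      mult (\<alpha> x) (mult y z) = - mult (mult x y) (\<alpha> z)"

text \<open>
  Linear maps \<open>L, R : A \<rightarrow> End(V)\<close> are the same thing as bilinear maps \<open>A \<times> V \<rightarrow> V\<close> in curried form.
\<close>

locale hom_anti_associative_bimodule =
  hom_anti_associative_algebra scaleA A mult \<alpha> + V: vector_space scaleV
  for scaleA :: "'f::field \<Rightarrow> 'a::ab_group_add \<Rightarrow> 'a"
    and A mult \<alpha>
    and scaleV :: "'f \<Rightarrow> 'v::ab_group_add \<Rightarrow> 'v" +
  fixes V :: "'v set"
    and L R :: "'a \<Rightarrow> 'v \<Rightarrow> 'v"
    and \<beta> :: "'v \<Rightarrow> 'v"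
  assumes subspace_V: "V.subspace V"
    and bilinear_L: "bilinear_on scaleA scaleV scaleV A V V L"
    and bilinear_R: "bilinear_on scaleA scaleV scaleV A V V R"
    and linear_\<beta>: "linear_on scaleV scaleV V V \<beta>"
    and L_L: "\<lbrakk>a \<in> A; b \<in> A; m \<in> V\<rbrakk> \<Longrightarrow> L (\<alpha> a) (L b m) = - L (mult a b) (\<beta> m)"
    and R_R: "\<lbrakk>a \<in> A; b \<in> A; m \<in> V\<rbrakk> \<Longrightarrow> R (\<alpha> b) (R a m) = - R (mult a b) (\<beta> m)"
    and L_R: "\<lbrakk>a \<in> A; b \<in> A; m \<in> V\<rbrakk> \<Longrightarrow> L (\<alpha> a) (R b m) = - R (\<alpha> b) (L a m)"
    and \<beta>_L: "\<lbrakk>a \<in> A; m \<in> V\<rbrakk> \<Longrightarrow> \<beta> (L a m) = L (\<alpha> a) (\<beta> m)"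
    and \<beta>_R: "\<lbrakk>a \<in> A; m \<in> V\<rbrakk> \<Longrightarrow> \<beta> (R a m) = R (\<alpha> a) (\<beta> m)"

locale O_operator =
  hom_anti_associative_bimodule scaleA A mult \<alpha> scaleV V L R \<beta>
  for scaleA :: "'f::field \<Rightarrow> 'a::ab_group_add \<Rightarrow> 'a"
    and A mult \<alpha>
    and scaleV :: "'f \<Rightarrow> 'v::ab_group_add \<Rightarrow> 'v"
    and V L R \<beta> +
  fixes T :: "'v \<Rightarrow> 'a"
  assumes linear_T: "linear_on scaleV scaleA V A T"
    and T_\<beta>: "u \<in> V \<Longrightarrow> T (\<beta> u) = \<alpha> (T u)"
    and T_mult: "\<lbrakk>u \<in> V; v \<in> V\<rbrakk> \<Longrightarrow> mult (T u) (T v) = T (L (T u) v + R (T v) u)"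

locale hom_rhizaform_algebra = vector_space scale
  for scale :: "'f::field \<Rightarrow> 'a::ab_group_add \<Rightarrow> 'a" +
  fixes A :: "'a set"
    and rsucc :: "'a \<Rightarrow> 'a \<Rightarrow> 'a"  (infixl "\<succ>" 70)
    and rprec :: "'a \<Rightarrow> 'a \<Rightarrow> 'a"  (infixl "\<prec>" 70)
    and \<alpha> :: "'a \<Rightarrow> 'a"
  assumes subspace_carrier: "subspace A"
    and bilinear_rsucc: "bilinear_on scale scale scale A A A (\<succ>)"
    and bilinear_rprec: "bilinear_on scale scale scale A A A (\<prec>)"
    and linear_map: "linear_on scale scale A A \<alpha>"
    and map_rprec: "\<lbrakk>x \<in> A; y \<in> A\<rbrakk> \<Longrightarrow> \<alpha> (x \<prec> y) = \<alpha> x \<prec> \<alpha> y"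
    and map_rsucc: "\<lbrakk>x \<in> A; y \<in> A\<rbrakk> \<Longrightarrow> \<alpha> (x \<succ> y) = \<alpha> x \<succ> \<alpha> y"
    and rsucc_rsucc: "\<lbrakk>x \<in> A; y \<in> A; z \<in> A\<rbrakk> \<Longrightarrow>
      (x \<succ> y + x \<prec> y) \<succ> \<alpha> z = - (\<alpha> x \<succ> (y \<succ> z))"
    and rprec_rprec: "\<lbrakk>x \<in> A; y \<in> A; z \<in> A\<rbrakk> \<Longrightarrow>
      \<alpha> x \<prec> (y \<succ> z + y \<prec> z) = - ((x \<prec> y) \<prec> \<alpha> z)"
    and rsucc_rprec: "\<lbrakk>x \<in> A; y \<in> A; z \<in> A\<rbrakk> \<Longrightarrow>
      \<alpha> x \<succ> (y \<prec> z) = - ((x \<succ> y) \<prec> \<alpha> z)"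

definition associated_mult ::
  "('a::ab_group_add \<Rightarrow> 'a \<Rightarrow> 'a) \<Rightarrow> ('a \<Rightarrow> 'a \<Rightarrow> 'a) \<Rightarrow> 'a \<Rightarrow> 'a \<Rightarrow> 'a" where
  "associated_mult rsucc rprec x y = rsucc x y + rprec x y"

locale hom_anti_associative_homomorphism =
  dom: hom_anti_associative_algebra scale1 A1 mult1 \<alpha>1 +
  cod: hom_anti_associative_algebra scale2 A2 mult2 \<alpha>2
  for scale1 :: "'f::field \<Rightarrow> 'a::ab_group_add \<Rightarrow> 'a"
    and A1 mult1 \<alpha>1
    and scale2 :: "'f \<Rightarrow> 'b::ab_group_add \<Rightarrow> 'b"
    and A2 mult2 \<alpha>2 +
  fixes \<pi> :: "'a \<Rightarrow> 'b"
  assumes linear_hom: "linear_on scale1 scale2 A1 A2 \<pi>"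
    and hom_mult: "\<lbrakk>x \<in> A1; y \<in> A1\<rbrakk> \<Longrightarrow> \<pi> (mult1 x y) = mult2 (\<pi> x) (\<pi> y)"
    and hom_map: "x \<in> A1 \<Longrightarrow> \<pi> (\<alpha>1 x) = \<alpha>2 (\<pi> x)"

locale hom_rhizaform_homomorphism =
  dom: hom_rhizaform_algebra scale1 A1 rsucc1 rprec1 \<alpha>1 +
  cod: hom_rhizaform_algebra scale2 A2 rsucc2 rprec2 \<alpha>2
  for scale1 :: "'f::field \<Rightarrow> 'a::ab_group_add \<Rightarrow> 'a"
    and A1 rsucc1 rprec1 \<alpha>1
    and scale2 :: "'f \<Rightarrow> 'b::ab_group_add \<Rightarrow> 'b"
    and A2 rsucc2 rprec2 \<alpha>2 +
  fixes \<pi> :: "'a \<Rightarrow> 'b"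
  assumes linear_hom: "linear_on scale1 scale2 A1 A2 \<pi>"
    and hom_rsucc: "\<lbrakk>x \<in> A1; y \<in> A1\<rbrakk> \<Longrightarrow> \<pi> (rsucc1 x y) = rsucc2 (\<pi> x) (\<pi> y)"
    and hom_rprec: "\<lbrakk>x \<in> A1; y \<in> A1\<rbrakk> \<Longrightarrow> \<pi> (rprec1 x y) = rprec2 (\<pi> x) (\<pi> y)"
    and hom_map: "x \<in> A1 \<Longrightarrow> \<pi> (\<alpha>1 x) = \<alpha>2 (\<pi> x)"

end

theory Submission
  imports Defs
begin

text \<open>
  Evaluated at arguments from the image of \<open>T\<close>, the bimodule axioms are the rhizaform axioms: the sum \<open>u \<succ> v + u \<prec> v\<close> is sent by
  \<open>T\<close> to the product \<open>T u \<cdot> T v\<close>, so the axiom for \<open>L (a \<cdot> b)\<close> becomes the one for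
  \<open>(x \<succ> y + x \<prec> y) \<succ> \<beta> z\<close>, the axiom for \<open>R (a \<cdot> b)\<close> becomes the one for
  \<open>\<beta> x \<prec> (y \<succ> z + y \<prec> z)\<close>, and the compatibility of \<open>L\<close> with \<open>R\<close> becomes the mixed one
  (\<open>O_operator.hom_rhizaform_algebra_V\<close>). The same identity says that \<open>T\<close> is
  multiplicative for the associated product, and \<open>\<beta>\<close> preserves both operations
  by the two bimodule axioms that relate it to \<open>L\<close> and \<open>R\<close>.

  All rhizaform axioms are identities between bilinear or linear expressions, so they pass to the
  image of any linear map that intertwines the structure maps and along which the two operations
  descend
  (\<open>hom_rhizaform_algebra.homomorphism_onto_image\<close>). Thus what remains is that \<open>T (u \<succ> v)\<close> and
  \<open>T (u \<prec> v)\<close> depend only on \<open>T u\<close> and \<open>T v\<close>. For \<open>T (L (T u) v)\<close> the dependence on \<open>u\<close> is clear,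
  and the dependence on \<open>v\<close> is seen from \<open>T (L (T u) v) = T u \<cdot> T v - T (R (T v) u)\<close>; the same
  equation, read for the other summand, handles \<open>T (R (T v) u)\<close>.
\<close>

lemma linear_on_closed: "linear_on s1 s2 A B f \<Longrightarrow> x \<in> A \<Longrightarrow> f x \<in> B"
  and linear_on_add: "linear_on s1 s2 A B f \<Longrightarrow> x \<in> A \<Longrightarrow> y \<in> A \<Longrightarrow> f (x + y) = f x + f y"
  and linear_on_scale: "linear_on s1 s2 A B f \<Longrightarrow> x \<in> A \<Longrightarrow> f (s1 c x) = s2 c (f x)"
  by (auto simp: linear_on_def)

lemma bilinear_on_iff:
  "bilinear_on s1 s2 s3 A B C f \<longleftrightarrow>
     (\<forall>x\<in>A. \<forall>y\<in>B. f x y \<in> C) \<and>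
     (\<forall>x\<in>A. \<forall>y\<in>B. \<forall>z\<in>B. f x (y + z) = f x y + f x z) \<and>
     (\<forall>c. \<forall>x\<in>A. \<forall>y\<in>B. f x (s2 c y) = s3 c (f x y)) \<and>
     (\<forall>x\<in>A. \<forall>y\<in>A. \<forall>z\<in>B. f (x + y) z = f x z + f y z) \<and>
     (\<forall>c. \<forall>x\<in>A. \<forall>y\<in>B. f (s1 c x) y = s3 c (f x y))"
  unfolding bilinear_on_def linear_on_def by blast

lemma linear_on_neg:
  assumes "linear_on s1 s2 A B f" "vector_space s1" "vector_space s2" "x \<in> A"
  shows "f (- x) = - f x"
proof -
  interpret v1: vector_space s1 by fact
  interpret v2: vector_space s2 by fact
  show ?thesis using linear_on_scale[OF assms(1,4), of "- 1"] by simp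
qed

lemma linear_on_image_subspace:
  assumes "linear_on s1 s2 A B f" "vector_space s1" "vector_space s2" "module.subspace s1 A"
  shows "module.subspace s2 (f ` A)"
proof -
  interpret v1: vector_space s1 by fact
  interpret v2: vector_space s2 by fact
  have "0 \<in> A" by (rule v1.subspace_0) fact
  moreover from this have "f 0 = 0" using linear_on_add[OF assms(1), of 0 0] by simp
  ultimately have "0 \<in> f ` A" by force
  moreover have "f x + f y \<in> f ` A" if "x \<in> A" "y \<in> A" for x y
    by (metis that linear_on_add[OF assms(1)] v1.subspace_add[OF assms(4)] imageI)
  moreover have "s2 c (f x) \<in> f ` A" if "x \<in> A" for c x
    by (metis that linear_on_scale[OF assms(1)] v1.subspace_scale[OF assms(4)] imageI)
  ultimately show ?thesis by (auto simp: v2.subspace_def)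
qed

lemma (in hom_rhizaform_algebra)
  shows rsucc_closed: "\<lbrakk>x \<in> A; y \<in> A\<rbrakk> \<Longrightarrow> x \<succ> y \<in> A"
    and rprec_closed: "\<lbrakk>x \<in> A; y \<in> A\<rbrakk> \<Longrightarrow> x \<prec> y \<in> A"
    and map_closed: "x \<in> A \<Longrightarrow> \<alpha> x \<in> A"
  using bilinear_rsucc bilinear_rprec linear_map
  by (auto simp: bilinear_on_iff dest: linear_on_closed)

text \<open>
  The sum of the three rhizaform axioms is Hom-anti-associativity of the sum of the operations.
\<close>

lemma (in hom_rhizaform_algebra) associated_hom_anti_associative_algebra:
  "hom_anti_associative_algebra scale A (associated_mult (\<succ>) (\<prec>)) \<alpha>"
proof unfold_locales
  show "bilinear_on scale scale scale A A A (associated_mult (\<succ>) (\<prec>))"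
    using bilinear_rsucc bilinear_rprec
    by (simp add: bilinear_on_iff associated_mult_def scale_right_distrib subspace_add
        subspace_carrier algebra_simps)
  fix x y z assume xyz: "x \<in> A" "y \<in> A" "z \<in> A"
  have split_succ: "\<alpha> x \<succ> (y \<succ> z + y \<prec> z) = \<alpha> x \<succ> (y \<succ> z) + \<alpha> x \<succ> (y \<prec> z)"
    using bilinear_rsucc xyz by (simp add: bilinear_on_iff map_closed rsucc_closed rprec_closed)
  have split_prec: "(x \<succ> y + x \<prec> y) \<prec> \<alpha> z = (x \<succ> y) \<prec> \<alpha> z + (x \<prec> y) \<prec> \<alpha> z"
    using bilinear_rprec xyz by (simp add: bilinear_on_iff map_closed rsucc_closed rprec_closed)
  show "associated_mult (\<succ>) (\<prec>) (\<alpha> x) (associated_mult (\<succ>) (\<prec>) y z)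
      = - associated_mult (\<succ>) (\<prec>) (associated_mult (\<succ>) (\<prec>) x y) (\<alpha> z)"
    using xyz unfolding associated_mult_def split_succ split_prec
    by (simp add: rsucc_rsucc rprec_rprec rsucc_rprec)
qed (rule subspace_carrier linear_map)+

text \<open>
  Each axiom for the images of \<open>x\<close>, \<open>y\<close>, \<open>z\<close> is \<open>T\<close> applied to the axiom for \<open>x\<close>, \<open>y\<close>, \<open>z\<close>. The
  equations for \<open>rs\<close> and \<open>rp\<close> say that the operations descend along \<open>T\<close>.
\<close>

lemma (in hom_rhizaform_algebra) homomorphism_onto_image:
  assumes "vector_space scale'"
    and lin: "linear_on scale scale' A B T"
    and map: "\<And>x. x \<in> A \<Longrightarrow> T (\<alpha> x) = \<alpha>' (T x)"
    and rs: "\<And>x y. \<lbrakk>x \<in> A; y \<in> A\<rbrakk> \<Longrightarrow> rs (T x) (T y) = T (x \<succ> y)"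
    and rp: "\<And>x y. \<lbrakk>x \<in> A; y \<in> A\<rbrakk> \<Longrightarrow> rp (T x) (T y) = T (x \<prec> y)"
  shows "hom_rhizaform_homomorphism scale A (\<succ>) (\<prec>) \<alpha> scale' (T ` A) rs rp \<alpha>' T"
proof -
  interpret v': vector_space scale' by fact
  note closed = rsucc_closed rprec_closed map_closed
    subspace_add[OF subspace_carrier] subspace_scale[OF subspace_carrier]
  note T_add = linear_on_add[OF lin, symmetric]
  note T_scale = linear_on_scale[OF lin, symmetric]
  have vs: "vector_space scale" by unfold_locales
  note T_neg = linear_on_neg[OF lin vs assms(1), symmetric]
  note T_simps = rs rp T_add T_scale T_neg map[symmetric] closed
  have "hom_rhizaform_algebra scale' (T ` A) rs rp \<alpha>'"
  proof unfold_locales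
    show "v'.subspace (T ` A)"
      using linear_on_image_subspace[OF lin vs assms(1) subspace_carrier] .
    show "bilinear_on scale' scale' scale' (T ` A) (T ` A) (T ` A) rs"
      using bilinear_rsucc by (simp add: bilinear_on_iff T_simps)
    show "bilinear_on scale' scale' scale' (T ` A) (T ` A) (T ` A) rp"
      using bilinear_rprec by (simp add: bilinear_on_iff T_simps)
    show "linear_on scale' scale' (T ` A) (T ` A) \<alpha>'"
      using linear_map by (auto simp: linear_on_def T_simps)
  qed (auto simp: T_simps map_rprec map_rsucc rsucc_rsucc rprec_rprec rsucc_rprec)
  moreover have "linear_on scale scale' A (T ` A) T"
    using lin unfolding linear_on_def by auto
  ultimately show ?thesis
    by (intro hom_rhizaform_homomorphism.intro hom_rhizaform_homomorphism_axioms.intro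
        hom_rhizaform_algebra_axioms) (auto simp: rs rp map)
qed

context O_operator
begin

lemma T_closed: "u \<in> V \<Longrightarrow> T u \<in> A"
  using linear_on_closed[OF linear_T] .

lemma \<beta>_closed: "u \<in> V \<Longrightarrow> \<beta> u \<in> V"
  using linear_on_closed[OF linear_\<beta>] .

lemma L_closed: "\<lbrakk>a \<in> A; u \<in> V\<rbrakk> \<Longrightarrow> L a u \<in> V"
  and R_closed: "\<lbrakk>a \<in> A; u \<in> V\<rbrakk> \<Longrightarrow> R a u \<in> V"
  using bilinear_L bilinear_R by (auto simp: bilinear_on_iff)

lemma T_mult_split: "\<lbrakk>u \<in> V; v \<in> V\<rbrakk> \<Longrightarrow> mult (T u) (T v) = T (L (T u) v) + T (R (T v) u)"
  by (simp add: T_mult linear_on_add[OF linear_T] L_closed R_closed T_closed)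

text \<open>
  Since \<open>T (x \<succ> y + x \<prec> y) = T x \<cdot> T y\<close> and \<open>\<alpha> (T x) = T (\<beta> x)\<close>, the rhizaform axioms are the
  bimodule axioms at \<open>T x\<close>, \<open>T y\<close> (or \<open>T y\<close>, \<open>T z\<close>, or \<open>T x\<close>, \<open>T z\<close>) applied to the remaining
  vector.
\<close>

lemma hom_rhizaform_algebra_V:
  assumes rs: "\<And>u v. \<lbrakk>u \<in> V; v \<in> V\<rbrakk> \<Longrightarrow> rs u v = L (T u) v"
    and rp: "\<And>u v. \<lbrakk>u \<in> V; v \<in> V\<rbrakk> \<Longrightarrow> rp u v = R (T v) u"
  shows "hom_rhizaform_algebra scaleV V rs rp \<beta>"
proof unfold_locales
  note closed = V.subspace_add[OF subspace_V] V.subspace_scale[OF subspace_V]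
    T_closed \<beta>_closed L_closed R_closed
  note T_lin = linear_on_add[OF linear_T] linear_on_scale[OF linear_T]
  show "bilinear_on scaleV scaleV scaleV V V V rs"
    using bilinear_L by (simp add: bilinear_on_iff rs closed T_lin)
  show "bilinear_on scaleV scaleV scaleV V V V rp"
    using bilinear_R by (simp add: bilinear_on_iff rp closed T_lin)
  fix x y assume xy: "x \<in> V" "y \<in> V"
  then show "\<beta> (rp x y) = rp (\<beta> x) (\<beta> y)" "\<beta> (rs x y) = rs (\<beta> x) (\<beta> y)"
    by (simp_all add: rs rp closed \<beta>_L \<beta>_R T_\<beta>)
  fix z assume z: "z \<in> V"
  show "rs (rs x y + rp x y) (\<beta> z) = - rs (\<beta> x) (rs y z)"
    using xy z by (simp add: rs rp closed T_mult[symmetric] L_L T_\<beta>)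
  show "rp (\<beta> x) (rs y z + rp y z) = - rp (rp x y) (\<beta> z)"
    using xy z by (simp add: rs rp closed T_mult[symmetric] R_R T_\<beta>)
  show "rs (\<beta> x) (rp y z) = - rp (rs x y) (\<beta> z)"
    using xy z by (simp add: rs rp closed L_R T_\<beta>)
qed (rule subspace_V linear_\<beta>)+

text \<open>
  In \<open>T u \<cdot> T v = T (L (T u) v) + T (R (T v) u)\<close> the second summand does not see a change of \<open>v\<close>
  within its fibre, and neither does the left-hand side; so the first summand does not either.
\<close>

lemma T_L_cong:
  assumes "v \<in> V" "v' \<in> V" "u \<in> V" "T v = T v'"
  shows "T (L (T u) v) = T (L (T u) v')"
  using T_mult_split[of u v] T_mult_split[of u v'] assms by simp

lemma T_R_cong:
  assumes "u \<in> V" "u' \<in> V" "v \<in> V" "T u = T u'"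
  shows "T (R (T v) u) = T (R (T v) u')"
  using T_mult_split[of u v] T_mult_split[of u' v] assms by simp

end

theorem theorem3p2:
  fixes scaleA :: "'f::field \<Rightarrow> 'a::ab_group_add \<Rightarrow> 'a"
    and A :: "'a set"
    and mult :: "'a \<Rightarrow> 'a \<Rightarrow> 'a"
    and \<alpha> :: "'a \<Rightarrow> 'a"
    and scaleV :: "'f \<Rightarrow> 'v::ab_group_add \<Rightarrow> 'v"
    and V :: "'v set"
    and L R :: "'a \<Rightarrow> 'v \<Rightarrow> 'v"
    and \<beta> :: "'v \<Rightarrow> 'v"
    and T :: "'v \<Rightarrow> 'a"
    and rsucc rprec :: "'v \<Rightarrow> 'v \<Rightarrow> 'v"
  assumes "hom_anti_associative_algebra scaleA A mult \<alpha>"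
    and "hom_anti_associative_bimodule scaleA A mult \<alpha> scaleV V L R \<beta>"
    and "O_operator scaleA A mult \<alpha> scaleV V L R \<beta> T"
    and "\<And>u v. u \<in> V \<Longrightarrow> v \<in> V \<Longrightarrow> rsucc u v = L (T u) v"
    and "\<And>u v. u \<in> V \<Longrightarrow> v \<in> V \<Longrightarrow> rprec u v = R (T v) u"
  shows "hom_rhizaform_algebra scaleV V rsucc rprec \<beta> \<and>
    hom_anti_associative_homomorphism
      scaleV V (associated_mult rsucc rprec) \<beta> scaleA A mult \<alpha> T \<and>
    (\<exists>rsucc' rprec'.
      hom_rhizaform_algebra scaleA (T ` V) rsucc' rprec' \<alpha> \<and>
      (\<forall>u\<in>V. \<forall>v\<in>V. rsucc' (T u) (T v) = T (rsucc u v) \<and>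
                     rprec' (T u) (T v) = T (rprec u v)) \<and>
      hom_rhizaform_homomorphism
        scaleV V rsucc rprec \<beta> scaleA (T ` V) rsucc' rprec' \<alpha> T)"
proof -
  interpret O_operator scaleA A mult \<alpha> scaleV V L R \<beta> T by fact
  note rs = assms(4) and rp = assms(5)
  interpret RV: hom_rhizaform_algebra scaleV V rsucc rprec \<beta>
    by (rule hom_rhizaform_algebra_V[OF rs rp])
  have hom: "hom_anti_associative_homomorphism
      scaleV V (associated_mult rsucc rprec) \<beta> scaleA A mult \<alpha> T"
    by (intro hom_anti_associative_homomorphism.intro
        hom_anti_associative_homomorphism_axioms.intro
        RV.associated_hom_anti_associative_algebra assms(1) linear_T)
      (simp_all add: associated_mult_def rs rp T_mult T_\<beta>)
  \<comment> \<open>An arbitrary section of \<open>T\<close> defines the operations on \<open>T ` V\<close>, by the two congruence lemmas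
    independently of the section.\<close>
  define sec where "sec = inv_into V T"
  define rs' where "rs' a b = T (rsucc (sec a) (sec b))" for a b
  define rp' where "rp' a b = T (rprec (sec a) (sec b))" for a b
  have sec: "sec (T u) \<in> V" "T (sec (T u)) = T u" if "u \<in> V" for u
    using that by (auto simp: sec_def inv_into_into f_inv_into_f)
  have rs': "rs' (T u) (T v) = T (rsucc u v)" if "u \<in> V" "v \<in> V" for u v
    using T_L_cong[of "sec (T v)" v u] that by (simp add: rs'_def rs sec)
  have rp': "rp' (T u) (T v) = T (rprec u v)" if "u \<in> V" "v \<in> V" for u v
    using T_R_cong[of "sec (T u)" u v] that by (simp add: rp'_def rp sec)
  have onto: "hom_rhizaform_homomorphism
      scaleV V rsucc rprec \<beta> scaleA (T ` V) rs' rp' \<alpha> T"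
    by (rule RV.homomorphism_onto_image[OF _ linear_T T_\<beta> rs' rp'])
      unfold_locales
  then have "hom_rhizaform_algebra scaleA (T ` V) rs' rp' \<alpha>"
    by (simp add: hom_rhizaform_homomorphism_def)
  with onto rs' rp' hom RV.hom_rhizaform_algebra_axioms show ?thesis by blast
qed

end
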